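(* Let $a>b>0$, $c^2=a^2-b^2$, and let $\mathcal{E}$ be the ellipse $x^2/a^2+y^2/b^2=1$. Let $a_\triangle=\frac{ac^2}{a^2+3b^2}$, $b_\triangle=\frac{bc^2}{3a^2+b^2}$, and let $C=[a_\triangle\cos t,\,b_\triangle\sin t]$ with $t\in\mathbb{R}$. Let $\mathcal{T}_\triangle$ be the Poncelet family of triangles inscribed in $\mathcal{E}$ and circumscribing a circle centered at $C$. Then the minor axis of the locus $\mathcal{L}_5$ of the Euler center $X_5$ over $\mathcal{T}_\triangle$ collapses to zero, and $\mathcal{L}_5$ is a line segment with one endpoint at $C$ and the other at $F'_{5,eq}$, of length $l_5$, where \[ l_5^2=\frac{c^8\left(a^6+15a^4b^2+15a^2b^4+b^6-c^6\cos(2t)\right)}{8\left(3a^5b+10a^3b^3+3ab^5\right)^2},\qquad F'_{5,eq}=\left[\frac{(a^4-b^4)\cos t}{2(a^3+3ab^2)},\;\frac{(a^4-b^4)\sin t}{2(3a^2b+b^3)}\right]. \]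
   Context: For each point $C=[x_c,y_c]$ interior to $\mathcal{E}$ there is exactly one circle $\mathcal{K}$ centered at $C$, nested in $\mathcal{E}$, admitting triangles inscribed in $\mathcal{E}$ with all sides tangent to $\mathcal{K}$; its radius is $r=\big(b\sqrt{a^4-c^2x_c^2}-a\sqrt{b^4+c^2y_c^2}\big)/c^2$. By Poncelet's porism every point of $\mathcal{E}$ is then a vertex of exactly one such triangle; the Poncelet family about the circle centered at $C$ is the family of all these triangles. The ellipse $\mathcal{E}_\triangle=\{[a_\triangle\cos t,b_\triangle\sin t]\}$ is the locus of centroids of all equilateral triangles inscribed in $\mathcal{E}$; when $C\in\mathcal{E}_\triangle$ the family contains an equilateral triangle. The locus of a triangle center is the set of its positions as the triangle ranges over the family. The Euler center $X_5$ is the center of the nine-point circle. For general $C$ the locus of $X_5$ is an ellipse. *)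

theory Defs
  imports "HOL-Analysis.Analysis"
begin

text \<open>
  The Euclidean plane is \<^typ>\<open>real \<times> real\<close>, whose distance and inner product in the library
  are the Euclidean ones. A triangle is the ordered triple of its vertices, which are required
  not to be collinear; the order of the vertices is immaterial.
\<close>

type_synonym point = "real \<times> real"

definition ellipse :: "real \<Rightarrow> real \<Rightarrow> point set" where
  "ellipse a b = {(x, y). x\<^sup>2 / a\<^sup>2 + y\<^sup>2 / b\<^sup>2 = 1}"

definition ellipse_inside :: "real \<Rightarrow> real \<Rightarrow> point set" where
  "ellipse_inside a b = {(x, y). x\<^sup>2 / a\<^sup>2 + y\<^sup>2 / b\<^sup>2 < 1}"

text \<open>
  A line is tangent to a circle if it meets it in exactly one point. Since the circles below lie
  inside the ellipse, the point of contact of a side line lies on the corresponding chord, so it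
  makes no difference that tangency is required of the side lines and not of the side segments.
\<close>

definition line_tangent :: "point \<Rightarrow> point \<Rightarrow> point \<Rightarrow> real \<Rightarrow> bool" where
  "line_tangent P Q C r \<longleftrightarrow> (\<exists>!X. X \<in> affine hull {P, Q} \<and> X \<in> sphere C r)"

definition inscribed_triangle :: "real \<Rightarrow> real \<Rightarrow> point \<Rightarrow> point \<Rightarrow> point \<Rightarrow> bool" where
  "inscribed_triangle a b P Q R \<longleftrightarrow>
     \<not> collinear {P, Q, R} \<and> P \<in> ellipse a b \<and> Q \<in> ellipse a b \<and> R \<in> ellipse a b"

text \<open>
  All triangles inscribed in the ellipse and circumscribing a nested circle centered at \<open>C\<close>. The
  radius is not fixed in advance: for \<open>C\<close> inside the ellipse exactly one radius
  admits such triangles.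
\<close>

definition poncelet_family :: "real \<Rightarrow> real \<Rightarrow> point \<Rightarrow> (point \<times> point \<times> point) set" where
  "poncelet_family a b C =
     {(P, Q, R). inscribed_triangle a b P Q R \<and>
        (\<exists>r>0. sphere C r \<subseteq> ellipse_inside a b \<and>
           line_tangent P Q C r \<and> line_tangent Q R C r \<and> line_tangent R P C r)}"

definition altitude :: "point \<Rightarrow> point \<Rightarrow> point \<Rightarrow> point set" where
  "altitude P Q R = {X. (X - P) \<bullet> (Q - R) = 0}"

definition orthocenters :: "point \<Rightarrow> point \<Rightarrow> point \<Rightarrow> point set" where
  "orthocenters P Q R = altitude P Q R \<inter> altitude Q R P \<inter> altitude R P Q"

definition altitude_feet :: "point \<Rightarrow> point \<Rightarrow> point \<Rightarrow> point set" where
  "altitude_feet P Q R = altitude P Q R \<inter> affine hull {Q, R}"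

text \<open>
  For a triangle, \<^const>\<open>orthocenters\<close> and \<^const>\<open>altitude_feet\<close> are singletons. The nine points
  are the midpoints of the sides, the feet of the altitudes, and the midpoints between the
  orthocenter and the vertices.
\<close>

definition nine_points :: "point \<Rightarrow> point \<Rightarrow> point \<Rightarrow> point set" where
  "nine_points P Q R =
     {midpoint Q R, midpoint R P, midpoint P Q}
     \<union> altitude_feet P Q R \<union> altitude_feet Q R P \<union> altitude_feet R P Q
     \<union> {midpoint H V | H V. H \<in> orthocenters P Q R \<and> V \<in> {P, Q, R}}"

definition is_euler_center :: "point \<Rightarrow> point \<Rightarrow> point \<Rightarrow> point \<Rightarrow> bool" where
  "is_euler_center N P Q R \<longleftrightarrow> (\<exists>\<rho>>0. nine_points P Q R \<subseteq> sphere N \<rho>)"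

definition euler_center_locus :: "real \<Rightarrow> real \<Rightarrow> point \<Rightarrow> point set" where
  "euler_center_locus a b C =
     {N. \<exists>P Q R. (P, Q, R) \<in> poncelet_family a b C \<and> is_euler_center N P Q R}"

text \<open>
  \<open>S\<close> is an ellipse whose axes have full lengths \<open>major\<close> and \<open>minor\<close>. Degenerate ellipses are
  allowed: with \<open>minor = 0\<close>, the set is a segment of length \<open>major\<close>.
\<close>

definition ellipse_with_axes :: "point set \<Rightarrow> real \<Rightarrow> real \<Rightarrow> bool" where
  "ellipse_with_axes S major minor \<longleftrightarrow> 0 \<le> minor \<and> minor \<le> major \<and>
     (\<exists>M u v. norm u = 1 \<and> norm v = 1 \<and> u \<bullet> v = 0 \<and>
        S = {M + (major / 2 * cos s) *\<^sub>R u + (minor / 2 * sin s) *\<^sub>R v | s. True})"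

end

theory Submission
  imports Defs "HOL-Computational_Algebra.Fundamental_Theorem_Algebra"
begin

text \<open>
  Vertices are parametrized by unit complex numbers, \<open>P = (a * Re z, b * Im z)\<close>. The affine image of
  the circle is an ellipse in the unit disc with foci \<open>f\<close>, \<open>g\<close>, and the triangles of the family are the
  solution triples of \<open>z (z - f) (z - g) = l (1 - cnj f z) (1 - cnj g z)\<close> with \<open>l\<close> on the unit circle; so
  \<open>z1 + z2 + z3 = f + g + l * cnj (f * g)\<close> and \<open>z1 * z2 * z3 = l\<close>. The coordinates of the Euler center are
  linear in the real and imaginary parts of these two quantities, hence it moves on an ellipse. If the
  family contains an equilateral triangle, then \<open>f * g = cnj w * v\<close>, where \<open>w = (f + g) / 2\<close> and \<open>v\<close> is
  the value of \<open>l\<close> at that triangle, and the coefficient of \<open>Im (l / v)\<close> vanishes.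
\<close>

subsection \<open>Chords of the ellipse tangent to a circle\<close>

definition cross :: "point \<Rightarrow> point \<Rightarrow> real" where
  "cross u v = fst u * snd v - snd u * fst v"

definition stretch :: "real \<Rightarrow> real \<Rightarrow> complex \<Rightarrow> point" where
  "stretch a b z = (a * Re z, b * Im z)"

lemma in_ellipse_iff:
  assumes "a > 0" "b > 0"
  shows "P \<in> ellipse a b \<longleftrightarrow> (\<exists>z. norm z = 1 \<and> P = stretch a b z)"
proof
  assume "P \<in> ellipse a b"
  then have "(fst P / a)\<^sup>2 + (snd P / b)\<^sup>2 = 1"
    by (auto simp: ellipse_def power_divide)
  then have "norm (Complex (fst P / a) (snd P / b)) = 1"
    by (simp add: cmod_def)
  moreover have "P = stretch a b (Complex (fst P / a) (snd P / b))"
    using assms by (simp add: stretch_def)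
  ultimately show "\<exists>z. norm z = 1 \<and> P = stretch a b z" by blast
next
  assume "\<exists>z. norm z = 1 \<and> P = stretch a b z"
  then show "P \<in> ellipse a b"
    using assms by (auto simp: ellipse_def stretch_def power_mult_distrib cmod_def)
qed

lemma quadratic_unique_root_iff:
  fixes A B D :: real
  assumes "A \<noteq> 0"
  shows "(\<exists>!x. A * x\<^sup>2 + 2 * B * x + D = 0) \<longleftrightarrow> B\<^sup>2 = A * D"
proof
  assume "\<exists>!x. A * x\<^sup>2 + 2 * B * x + D = 0"
  then obtain x where x: "A * x\<^sup>2 + 2 * B * x + D = 0"
    and uniq: "\<And>y. A * y\<^sup>2 + 2 * B * y + D = 0 \<Longrightarrow> y = x" by blast
  define h where "h = B / A"
  have B: "B = A * h" using assms by (simp add: h_def)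
  \<comment> \<open>The mirror image of a root in the axis of the parabola is again a root, so a
    unique root sits at the vertex.\<close>
  have "A * (- 2 * h - x)\<^sup>2 + 2 * B * (- 2 * h - x) + D = A * x\<^sup>2 + 2 * B * x + D"
    unfolding B by algebra
  also note x
  finally have "- 2 * h - x = x" by (rule uniq)
  then have "h = - x" by simp
  then have "B = - A * x" unfolding B by simp
  with x show "B\<^sup>2 = A * D" by algebra
next
  assume eq: "B\<^sup>2 = A * D"
  have *: "A * (A * x\<^sup>2 + 2 * B * x + D) = (A * x + B)\<^sup>2" for x
    using eq by algebra
  have "A * x\<^sup>2 + 2 * B * x + D = 0 \<longleftrightarrow> x = - B / A" for x
  proof -
    have "A * x\<^sup>2 + 2 * B * x + D = 0 \<longleftrightarrow> A * x + B = 0"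
      using *[of x] assms by (metis mult_eq_0_iff power2_eq_square)
    also have "\<dots> \<longleftrightarrow> x = - B / A"
      using assms by (auto simp: field_simps add_eq_0_iff)
    finally show ?thesis .
  qed
  then show "\<exists>!x. A * x\<^sup>2 + 2 * B * x + D = 0" by simp
qed

lemma ex1_in_range_iff:
  assumes "inj f"
  shows "(\<exists>!y. y \<in> range f \<and> y \<in> S) \<longleftrightarrow> (\<exists>!x. f x \<in> S)"
proof
  assume "\<exists>!y. y \<in> range f \<and> y \<in> S"
  then obtain x where "f x \<in> S" and "\<And>x'. f x' \<in> S \<Longrightarrow> f x' = f x" by blast
  then show "\<exists>!x. f x \<in> S" using injD[OF assms] by blast
next
  assume "\<exists>!x. f x \<in> S"
  then show "\<exists>!y. y \<in> range f \<and> y \<in> S" by blast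
qed

text \<open>Along the line the circle equation is a quadratic in the parameter, and tangency is a
  double root. Lagrange's identity turns the discriminant condition into: the distance from
  \<open>C\<close> to the line is \<open>r\<close>.\<close>

lemma line_tangent_iff:
  assumes "P \<noteq> Q" "r \<ge> 0"
  shows "line_tangent P Q C r \<longleftrightarrow> (cross (Q - P) (C - P))\<^sup>2 = r\<^sup>2 * (norm (Q - P))\<^sup>2"
proof -
  define d where "d = Q - P"
  have d: "d \<noteq> 0" using assms by (simp add: d_def)
  have hull: "affine hull {P, Q} = range (\<lambda>x. P + x *\<^sub>R d)"
    unfolding affine_hull_2_alt d_def by (rule refl)
  have sph: "P + x *\<^sub>R d \<in> sphere C r \<longleftrightarrow>
     (norm d)\<^sup>2 * x\<^sup>2 + 2 * ((P - C) \<bullet> d) * x + ((norm (P - C))\<^sup>2 - r\<^sup>2) = 0" for x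
  proof -
    have "P + x *\<^sub>R d \<in> sphere C r \<longleftrightarrow> (norm ((P - C) + x *\<^sub>R d))\<^sup>2 = r\<^sup>2"
      using assms(2) by (simp add: dist_norm norm_minus_commute algebra_simps)
    also have "(norm ((P - C) + x *\<^sub>R d))\<^sup>2 =
        (norm d)\<^sup>2 * x\<^sup>2 + 2 * ((P - C) \<bullet> d) * x + (norm (P - C))\<^sup>2"
      unfolding power2_norm_eq_inner
      by (simp add: inner_add_left inner_add_right inner_commute power2_eq_square)
    finally show ?thesis by linarith
  qed
  have "line_tangent P Q C r \<longleftrightarrow> (\<exists>!x. P + x *\<^sub>R d \<in> sphere C r)"
  proof -
    have "line_tangent P Q C r \<longleftrightarrow> (\<exists>!X. X \<in> range (\<lambda>x. P + x *\<^sub>R d) \<and> X \<in> sphere C r)"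
      by (simp only: line_tangent_def hull)
    also have "\<dots> \<longleftrightarrow> (\<exists>!x. P + x *\<^sub>R d \<in> sphere C r)"
      using d by (intro ex1_in_range_iff injI) simp
    finally show ?thesis .
  qed
  also have "\<dots> \<longleftrightarrow> ((P - C) \<bullet> d)\<^sup>2 = (norm d)\<^sup>2 * ((norm (P - C))\<^sup>2 - r\<^sup>2)"
    unfolding sph using d by (intro quadratic_unique_root_iff) simp
  also have "\<dots> \<longleftrightarrow> (cross d (C - P))\<^sup>2 = r\<^sup>2 * (norm d)\<^sup>2"
  proof -
    have "((P - C) \<bullet> d)\<^sup>2 + (cross d (C - P))\<^sup>2 = (norm d)\<^sup>2 * (norm (P - C))\<^sup>2"
      unfolding power2_norm_eq_inner cross_def inner_prod_def by (simp, algebra)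
    then show ?thesis by (auto simp: algebra_simps)
  qed
  finally show ?thesis by (simp add: d_def)
qed

lemma unit_cnj: "norm z = 1 \<Longrightarrow> z * cnj z = 1"
  by (simp add: complex_norm_square[symmetric])

text \<open>Conjugates of unit numbers are inverses, so multiplying by \<open>z1 * z2\<close> clears
  them. The last factor is the equation of the chord line through \<open>z1\<close> and
  \<open>z2\<close>, evaluated at \<open>w\<close>; the minus sign arises because \<open>E\<close>
  is purely imaginary.\<close>

lemma cross_stretch_sq:
  assumes "norm z1 = 1" "norm z2 = 1"
  shows "4 * (z1 * z2)\<^sup>2 * of_real ((cross (stretch a b z2 - stretch a b z1)
            (stretch a b w - stretch a b z1))\<^sup>2)
         = - (of_real (a * b) * (z2 - z1) * (w + z1 * z2 * cnj w - (z1 + z2)))\<^sup>2"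
proof -
  define D where "D = z2 - z1"
  define E where "E = cnj D * (w - z1) - D * cnj (w - z1)"
  have E: "4 * of_real ((cross (stretch a b z2 - stretch a b z1)
            (stretch a b w - stretch a b z1))\<^sup>2) = - (of_real (a * b) * E)\<^sup>2"
  proof -
    define y where "y = Re D * Im (w - z1) - Im D * Re (w - z1)"
    have "E = \<i> * of_real (2 * y)"
      by (simp add: complex_eq_iff E_def y_def algebra_simps)
    moreover have "cross (stretch a b z2 - stretch a b z1) (stretch a b w - stretch a b z1)
        = a * b * y"
      by (simp add: cross_def stretch_def D_def y_def algebra_simps)
    ultimately show ?thesis by (simp add: power_mult_distrib)
  qed
  have "z1 * z2 * E = - D * (w + z1 * z2 * cnj w - (z1 + z2))"
    using unit_cnj[OF assms(1)] unit_cnj[OF assms(2)]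
    unfolding E_def D_def complex_cnj_diff by algebra
  then have "(z1 * z2)\<^sup>2 * (of_real (a * b) * E)\<^sup>2
      = (of_real (a * b) * D * (w + z1 * z2 * cnj w - (z1 + z2)))\<^sup>2"
    by algebra
  moreover have "4 * M * X = - F" if "4 * X = - G" "M * G = F" for M X F G :: complex
    using that by algebra
  ultimately show ?thesis using E unfolding D_def by metis
qed

text \<open>For a chord \<open>D\<close> of the unit circle \<open>z1 * z2 * cnj D = - D\<close>,
  which removes the conjugates from \<open>D + cnj D\<close> and \<open>D - cnj D\<close>.\<close>

lemma norm_stretch_sq:
  assumes "norm z1 = 1" "norm z2 = 1"
  shows "4 * (z1 * z2)\<^sup>2 * of_real ((norm (stretch a b z2 - stretch a b z1))\<^sup>2)
         = (z2 - z1)\<^sup>2 * (of_real (a\<^sup>2) * (z1 * z2 - 1)\<^sup>2 - of_real (b\<^sup>2) * (z1 * z2 + 1)\<^sup>2)"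
proof -
  define D where "D = z2 - z1"
  have n: "(norm (stretch a b z2 - stretch a b z1))\<^sup>2 = a\<^sup>2 * (Re D)\<^sup>2 + b\<^sup>2 * (Im D)\<^sup>2"
    unfolding power2_norm_eq_inner
    by (simp add: stretch_def D_def power2_eq_square algebra_simps)
  have ReIm: "4 * of_real ((Re D)\<^sup>2) = (D + cnj D)\<^sup>2" "4 * of_real ((Im D)\<^sup>2) = - (D - cnj D)\<^sup>2"
    by (simp_all add: complex_add_cnj complex_diff_cnj power_mult_distrib)
  have *: "4 * of_real ((norm (stretch a b z2 - stretch a b z1))\<^sup>2)
      = of_real (a\<^sup>2) * (D + cnj D)\<^sup>2 - of_real (b\<^sup>2) * (D - cnj D)\<^sup>2"
    using ReIm unfolding n of_real_add of_real_mult by algebra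
  have "z1 * z2 * cnj D = - D"
    using unit_cnj[OF assms(1)] unit_cnj[OF assms(2)]
    unfolding D_def complex_cnj_diff by algebra
  with * show ?thesis unfolding D_def[symmetric] by algebra
qed

text \<open>
  The condition that the chord of the unit circle through \<open>z1\<close> and \<open>z2\<close> touches a conic whose foci
  are the roots of \<open>z\<^sup>2 - p * z + q\<close>; \<open>\<kappa>\<close> encodes the length of its axes.
\<close>
definition chord_form :: "complex \<Rightarrow> complex \<Rightarrow> complex \<Rightarrow> complex \<Rightarrow> complex \<Rightarrow> complex" where
  "chord_form p q \<kappa> z1 z2 = q + cnj q * (z1 * z2)\<^sup>2 + (z1 + z2)\<^sup>2 - p * (z1 + z2)
     - cnj p * (z1 * z2) * (z1 + z2) + \<kappa> * (z1 * z2)"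

text \<open>Pulled back by \<open>stretch a b\<close>, the circle is an ellipse centered at
  \<open>w\<close> with semi-axes \<open>r / a\<close> and \<open>r / b\<close>, which determine the
  sum and the product of its foci. The distance equation is the chord form up to nonzero
  factors.\<close>

lemma line_tangent_stretch_iff:
  assumes "a > 0" "b > 0" "r \<ge> 0" "norm z1 = 1" "norm z2 = 1" "z1 \<noteq> z2"
  shows "line_tangent (stretch a b z1) (stretch a b z2) (stretch a b w) r \<longleftrightarrow>
    chord_form (2 * w) (w\<^sup>2 + of_real (r\<^sup>2 / b\<^sup>2 - r\<^sup>2 / a\<^sup>2))
      (of_real (2 * ((norm w)\<^sup>2 - r\<^sup>2 / a\<^sup>2 - r\<^sup>2 / b\<^sup>2))) z1 z2 = 0"
proof -
  let ?P = "stretch a b z1" and ?Q = "stretch a b z2"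
  let ?X = "(cross (?Q - ?P) (stretch a b w - ?P))\<^sup>2" and ?Y = "r\<^sup>2 * (norm (?Q - ?P))\<^sup>2"
  define R1 R2 where "R1 = r\<^sup>2 / a\<^sup>2" and "R2 = r\<^sup>2 / b\<^sup>2"
  have R: "r\<^sup>2 * a\<^sup>2 = (a * b)\<^sup>2 * R2" "r\<^sup>2 * b\<^sup>2 = (a * b)\<^sup>2 * R1"
    using assms(1,2) by (simp_all add: R1_def R2_def field_simps power_mult_distrib)
  have ne: "?P \<noteq> ?Q" using assms by (auto simp: stretch_def complex_eq_iff)
  have z0: "z1 \<noteq> 0" "z2 \<noteq> 0" using assms by auto
  define Lf where "Lf = chord_form (2 * w) (w\<^sup>2 + of_real (R2 - R1))
      (of_real (2 * ((norm w)\<^sup>2 - R1 - R2))) z1 z2"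
  have Y: "4 * (z1 * z2)\<^sup>2 * of_real ?Y = (of_real (a * b) * (z2 - z1))\<^sup>2 *
      (of_real R2 * (z1 * z2 - 1)\<^sup>2 - of_real R1 * (z1 * z2 + 1)\<^sup>2)"
  proof -
    have "4 * (z1 * z2)\<^sup>2 * of_real ?Y = (z2 - z1)\<^sup>2 *
      (of_real (r\<^sup>2 * a\<^sup>2) * (z1 * z2 - 1)\<^sup>2 - of_real (r\<^sup>2 * b\<^sup>2) * (z1 * z2 + 1)\<^sup>2)"
      using norm_stretch_sq[OF assms(4,5), of a b] unfolding of_real_mult by algebra
    then show ?thesis unfolding R of_real_mult of_real_power by algebra
  qed
  have nw: "(of_real (norm w))\<^sup>2 = w * cnj w" unfolding of_real_power[symmetric] by (rule complex_norm_square)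
  have L: "(w + z1 * z2 * cnj w - (z1 + z2))\<^sup>2 + (of_real R2 * (z1 * z2 - 1)\<^sup>2
      - of_real R1 * (z1 * z2 + 1)\<^sup>2) = Lf"
    by (simp add: Lf_def chord_form_def nw, simp add: power2_eq_square algebra_simps)
  have combine: "M * (X - Y) = - (A * D)\<^sup>2 * F"
    if "M * X = - (A * D * G)\<^sup>2" "M * Y = (A * D)\<^sup>2 * S" "G\<^sup>2 + S = F" for M X Y A D G S F :: complex
    using that by algebra
  have X: "4 * (z1 * z2)\<^sup>2 * of_real (?X - ?Y) = - (of_real (a * b) * (z2 - z1))\<^sup>2 * Lf"
    unfolding of_real_diff by (rule combine[OF cross_stretch_sq[OF assms(4,5)] Y L])
  have "?X = ?Y \<longleftrightarrow> 4 * (z1 * z2)\<^sup>2 * of_real (?X - ?Y) = 0"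
    using z0 by (simp del: of_real_diff)
  also have "\<dots> \<longleftrightarrow> Lf = 0"
    unfolding X using assms by simp
  finally show ?thesis
    unfolding line_tangent_iff[OF ne assms(3)] Lf_def R1_def R2_def by simp
qed

subsection \<open>Poncelet triangles and Blaschke products\<close>

lemma chord_form_commute: "chord_form p q \<kappa> z1 z2 = chord_form p q \<kappa> z2 z1"
  by (simp add: chord_form_def algebra_simps)

text \<open>For fixed \<open>z1\<close> the chord form is a quadratic in the other endpoint that
  vanishes at \<open>z2\<close> and \<open>z3\<close>. Eliminating its linear coefficient, which
  contains \<open>\<kappa>\<close>, leaves a relation for \<open>z2 * z3\<close>; times
  \<open>z1\<close> it is the cubic.\<close>

lemma cubic_root_of_chord_forms:
  assumes "chord_form p q \<kappa> z1 z2 = 0" "chord_form p q \<kappa> z1 z3 = 0" "z2 \<noteq> z3"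
  shows "z1 ^ 3 - (p + z1 * z2 * z3 * cnj q) * z1\<^sup>2 + (q + z1 * z2 * z3 * cnj p) * z1 - z1 * z2 * z3 = 0"
proof -
  have "(z2 - z3) * ((1 - cnj p * z1 + cnj q * z1\<^sup>2) * (z2 * z3) - (q + z1\<^sup>2 - p * z1)) = 0"
    using assms(1,2) unfolding chord_form_def by algebra
  with assms(3) have "(1 - cnj p * z1 + cnj q * z1\<^sup>2) * (z2 * z3) - (q + z1\<^sup>2 - p * z1) = 0"
    by simp
  then show ?thesis by algebra
qed

lemma cubic_vieta:
  fixes z1 z2 z3 S T U :: "'a :: field"
  assumes "z1 ^ 3 - S * z1\<^sup>2 + T * z1 - U = 0" "z2 ^ 3 - S * z2\<^sup>2 + T * z2 - U = 0"
    "z3 ^ 3 - S * z3\<^sup>2 + T * z3 - U = 0" "z1 \<noteq> z2" "z2 \<noteq> z3" "z3 \<noteq> z1"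
  shows "z1 + z2 + z3 = S" "z1 * z2 + z2 * z3 + z3 * z1 = T"
proof -
  have "(z1 - z2) * (z1\<^sup>2 + z1 * z2 + z2\<^sup>2 - S * (z1 + z2) + T) = 0"
    using assms(1,2) by algebra
  with assms have 1: "z1\<^sup>2 + z1 * z2 + z2\<^sup>2 - S * (z1 + z2) + T = 0" by simp
  have "(z1 - z3) * (z1\<^sup>2 + z1 * z3 + z3\<^sup>2 - S * (z1 + z3) + T) = 0"
    using assms(1,3) by algebra
  with assms have 2: "z1\<^sup>2 + z1 * z3 + z3\<^sup>2 - S * (z1 + z3) + T = 0" by simp
  have "(z2 - z3) * (z1 + z2 + z3 - S) = 0" using 1 2 by algebra
  with assms show 3: "z1 + z2 + z3 = S" by simp
  show "z1 * z2 + z2 * z3 + z3 * z1 = T" using 1 3 by algebra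
qed

text \<open>The coefficients of the cubic involve the vertices only through
  \<open>z1 * z2 * z3\<close>, so all three vertices are roots of the same cubic.\<close>

lemma chord_forms_imp_vieta:
  assumes "chord_form p q \<kappa> z1 z2 = 0" "chord_form p q \<kappa> z2 z3 = 0" "chord_form p q \<kappa> z3 z1 = 0"
    and "z1 \<noteq> z2" "z2 \<noteq> z3" "z3 \<noteq> z1"
  shows "z1 + z2 + z3 = p + z1 * z2 * z3 * cnj q"
    and "z1 * z2 + z2 * z3 + z3 * z1 = q + z1 * z2 * z3 * cnj p"
proof -
  note c = assms(1-3)
  note cc = c[unfolded chord_form_commute[of p q \<kappa> z1 z2]]
    c[unfolded chord_form_commute[of p q \<kappa> z2 z3]] c[unfolded chord_form_commute[of p q \<kappa> z3 z1]]
  have perm: "z2 * z3 * z1 = z1 * z2 * z3" "z3 * z1 * z2 = z1 * z2 * z3" by (simp_all add: mult_ac)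
  note r1 = cubic_root_of_chord_forms[OF c(1) cc(9) assms(5)]
  note r2 = cubic_root_of_chord_forms[OF c(2) cc(1) assms(6), unfolded perm]
  note r3 = cubic_root_of_chord_forms[OF c(3) cc(5) assms(4), unfolded perm]
  show "z1 + z2 + z3 = p + z1 * z2 * z3 * cnj q"
    "z1 * z2 + z2 * z3 + z3 * z1 = q + z1 * z2 * z3 * cnj p"
    by (rule cubic_vieta[OF r1 r2 r3 assms(4-6)])+
qed

text \<open>The factor in front of \<open>z1 * z2\<close> does not depend on the triple. This is
  Poncelet's porism: if it vanishes, every side of every such triple is tangent.\<close>

lemma chord_form_of_vieta:
  assumes "z1 + z2 + z3 = p + z1 * z2 * z3 * cnj q"
    and "z1 * z2 + z2 * z3 + z3 * z1 = q + z1 * z2 * z3 * cnj p"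
  shows "chord_form p q \<kappa> z1 z2 = (\<kappa> - (p * cnj p - q * cnj q - 1)) * (z1 * z2)"
  using assms unfolding chord_form_def by algebra

section \<open>Unimodular solutions of the Blaschke equation\<close>

lemma cubic_splits:
  fixes S T U :: "'a :: alg_closed_field"
  obtains z1 z2 z3 where "z1 + z2 + z3 = S" "z1 * z2 + z2 * z3 + z3 * z1 = T" "z1 * z2 * z3 = U"
proof -
  let ?p = "[: - U, T, - S, 1 :]"
  have "?p \<noteq> 0" by simp
  from alg_closed_imp_factorization[OF this]
  obtain A where "size A = degree ?p" "?p = smult (lead_coeff ?p) (\<Prod>x\<in>#A. [:- x, 1:])" by blast
  then have A: "size A = 3" "?p = (\<Prod>x\<in>#A. [:- x, 1:])" by simp_all
  obtain xs where xs: "A = mset xs" using ex_mset[of A] by metis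
  then have "length xs = 3" using A(1) by simp
  then obtain z1 z2 z3 where "A = {#z1, z2, z3#}"
    using xs by (auto simp: numeral_3_eq_3 length_Suc_conv)
  with A(2) have "?p = [:- z1, 1:] * ([:- z2, 1:] * [:- z3, 1:])" by simp
  then have "z1 + z2 + z3 = S" "z1 * z2 + z2 * z3 + z3 * z1 = T" "z1 * z2 * z3 = U"
    by (auto simp: algebra_simps add_eq_0_iff)
  then show thesis by (rule that)
qed

text \<open>For \<open>norm f < 1\<close> the right side is positive inside the unit circle and
  negative outside, which compares the numerator and denominator of a Blaschke factor.\<close>

lemma norm_blaschke_factor:
  "(norm (1 - cnj f * z))\<^sup>2 - (norm (z - f))\<^sup>2 = (1 - (norm z)\<^sup>2) * (1 - (norm f)\<^sup>2)"
  unfolding cmod_power2 by (simp add: power2_eq_square algebra_simps)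

text \<open>Off the unit circle the moduli of the two sides differ: the left one is smaller inside
  and larger outside.\<close>

lemma blaschke_root_norm:
  assumes "norm f < 1" "norm g < 1" "norm l = 1"
    and "z * ((z - f) * (z - g)) = l * ((1 - cnj f * z) * (1 - cnj g * z))"
  shows "norm z = 1"
proof -
  have eq: "norm z * (norm (z - f) * norm (z - g)) = norm (1 - cnj f * z) * norm (1 - cnj g * z)"
    using arg_cong[OF assms(4), of norm] assms(3) by (simp add: norm_mult)
  have sq: "1 - (norm h)\<^sup>2 > 0" if "norm h < 1" for h :: complex
    using that by (simp add: abs_square_less_1)
  consider "norm z < 1" | "norm z = 1" | "norm z > 1" by linarith
  then show ?thesis
  proof cases
    case 1
    have less: "norm (z - h) < norm (1 - cnj h * z)" if "norm h < 1" for h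
    proof (rule power2_less_imp_less)
      have "0 < (1 - (norm z)\<^sup>2) * (1 - (norm h)\<^sup>2)" using sq[OF 1] sq[OF that] by simp
      then show "(norm (z - h))\<^sup>2 < (norm (1 - cnj h * z))\<^sup>2"
        unfolding norm_blaschke_factor[symmetric] by simp
    qed simp
    have "norm z * (norm (z - f) * norm (z - g)) \<le> norm (z - f) * norm (z - g)"
      using 1 by (intro mult_left_le_one_le) auto
    also have "\<dots> < norm (1 - cnj f * z) * norm (1 - cnj g * z)"
      using less assms(1,2) by (intro mult_strict_mono') auto
    finally show ?thesis using eq by simp
  next
    case 3
    have less: "norm (1 - cnj h * z) < norm (z - h)" if "norm h < 1" for h
    proof (rule power2_less_imp_less)
      have "(norm z)\<^sup>2 > 1" using 3 by simp
      then have "(1 - (norm z)\<^sup>2) * (1 - (norm h)\<^sup>2) < 0"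
        using sq[OF that] by (intro mult_neg_pos) auto
      then show "(norm (1 - cnj h * z))\<^sup>2 < (norm (z - h))\<^sup>2"
        unfolding norm_blaschke_factor[symmetric] by simp
    qed simp
    have "norm (1 - cnj f * z) * norm (1 - cnj g * z) < norm (z - f) * norm (z - g)"
      using less assms(1,2) by (intro mult_strict_mono') auto
    also have "\<dots> \<le> norm z * (norm (z - f) * norm (z - g))"
      using 3 by (simp add: mult_le_cancel_right1 not_less)
    finally show ?thesis using eq by simp
  qed
qed

text \<open>Let \<open>B\<close> be the product of \<open>z\<close> and the two Blaschke factors. On
  the unit circle \<open>z * B' / B\<close> is 1 plus the positive terms
  \<open>(1 - (norm f)\<^sup>2) / (norm (z - f))\<^sup>2\<close> and its analogue for
  \<open>g\<close>; a double root would make it zero.\<close>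

lemma blaschke_root_simple:
  assumes "norm f < 1" "norm g < 1" "norm z = 1"
    and "z * ((z - f) * (z - g)) = l * ((1 - cnj f * z) * (1 - cnj g * z))"
  shows "(z - f) * (z - g) + z * ((z - f) + (z - g))
    \<noteq> l * (- cnj f * (1 - cnj g * z) - cnj g * (1 - cnj f * z))"
proof
  assume deriv: "(z - f) * (z - g) + z * ((z - f) + (z - g))
    = l * (- cnj f * (1 - cnj g * z) - cnj g * (1 - cnj f * z))"
  define F G where "F = z - f" and "G = z - g"
  have z: "z * cnj z = 1" "z \<noteq> 0" using assms(3) by (auto simp: unit_cnj)
  have Fc: "1 - cnj f * z = z * cnj F" and Gc: "1 - cnj g * z = z * cnj G"
    using z by (simp_all add: F_def G_def algebra_simps)
  have f: "z * cnj F + F * cnj f = 1 - f * cnj f" and g: "z * cnj G + G * cnj g = 1 - g * cnj g"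
    using z by (simp_all add: F_def G_def algebra_simps)
  have "z * (F * G) = l * ((z * cnj F) * (z * cnj G))"
    using assms(4) by (simp add: Fc Gc F_def G_def)
  moreover have "F * G + z * (F + G) = l * (- cnj f * (z * cnj G) - cnj g * (z * cnj F))"
    using deriv unfolding Fc Gc F_def[symmetric] G_def[symmetric] .
  \<comment> \<open>\<open>l\<close> is eliminated between the equation and its derivative.\<close>
  ultimately have "z\<^sup>2 * (F * cnj F * (G * cnj G) + G * cnj G * (z * cnj F + F * cnj f)
      + F * cnj F * (z * cnj G + G * cnj g)) = 0"
    by algebra
  then have "F * cnj F * (G * cnj G) + G * cnj G * (1 - f * cnj f) + F * cnj F * (1 - g * cnj g) = 0"
    using z f g by simp
  then have "of_real ((norm F)\<^sup>2 * (norm G)\<^sup>2 + (norm G)\<^sup>2 * (1 - (norm f)\<^sup>2)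
      + (norm F)\<^sup>2 * (1 - (norm g)\<^sup>2)) = (0 :: complex)"
    by (simp add: complex_norm_square[symmetric] flip: of_real_power)
  then have *: "(norm F)\<^sup>2 * (norm G)\<^sup>2 + (norm G)\<^sup>2 * (1 - (norm f)\<^sup>2) + (norm F)\<^sup>2 * (1 - (norm g)\<^sup>2) = 0"
    by (simp only: of_real_eq_0_iff)
  have "norm F > 0" "norm G > 0" using assms by (auto simp: F_def G_def)
  moreover have "1 - (norm f)\<^sup>2 > 0" "1 - (norm g)\<^sup>2 > 0"
    using assms by (simp_all add: abs_square_less_1)
  ultimately have "(norm F)\<^sup>2 * (norm G)\<^sup>2 + (norm G)\<^sup>2 * (1 - (norm f)\<^sup>2) + (norm F)\<^sup>2 * (1 - (norm g)\<^sup>2) > 0"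
    by (intro add_pos_pos mult_pos_pos) auto
  with * show False by simp
qed

text \<open>The Blaschke equation with denominators cleared is a cubic with these symmetric
  functions. \<open>blaschke_root_norm\<close> puts its roots on the unit circle, and
  \<open>blaschke_root_simple\<close> separates them, since the derivative vanishes at a repeated
  root.\<close>

lemma blaschke_triple_exists:
  assumes "norm f < 1" "norm g < 1" "norm l = 1"
  obtains z1 z2 z3 where "norm z1 = 1" "norm z2 = 1" "norm z3 = 1"
    "z1 \<noteq> z2" "z2 \<noteq> z3" "z3 \<noteq> z1" "z1 * z2 * z3 = l"
    "z1 + z2 + z3 = (f + g) + l * cnj (f * g)" "z1 * z2 + z2 * z3 + z3 * z1 = f * g + l * cnj (f + g)"
proof -
  obtain z1 z2 z3 where s: "z1 + z2 + z3 = (f + g) + l * cnj (f * g)"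
    "z1 * z2 + z2 * z3 + z3 * z1 = f * g + l * cnj (f + g)" "z1 * z2 * z3 = l"
    by (rule cubic_splits)
  have fac: "z * ((z - f) * (z - g)) - l * ((1 - cnj f * z) * (1 - cnj g * z))
      = (z - z1) * (z - z2) * (z - z3)" for z
    using s unfolding complex_cnj_add complex_cnj_mult by algebra
  have unit: "norm z = 1" if "(z - z1) * (z - z2) * (z - z3) = 0" for z
    using fac[of z] unfolding that by (intro blaschke_root_norm[OF assms]) (simp only: right_minus_eq)
  have deriv: "(z - f) * (z - g) + z * ((z - f) + (z - g))
      - l * (- cnj f * (1 - cnj g * z) - cnj g * (1 - cnj f * z))
      = (z - z1) * (z - z2) + (z - z2) * (z - z3) + (z - z3) * (z - z1)" for z
    using s unfolding complex_cnj_add complex_cnj_mult by algebra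
  have simple: "(z - z1) * (z - z2) + (z - z2) * (z - z3) + (z - z3) * (z - z1) \<noteq> 0"
    if "(z - z1) * (z - z2) * (z - z3) = 0" for z
    using blaschke_root_simple[OF assms(1,2) unit[OF that], of l] fac[of z]
    unfolding deriv[symmetric] that by (simp only: right_minus_eq not_False_eq_True)
  show thesis
  proof (rule that)
    show "norm z1 = 1" "norm z2 = 1" "norm z3 = 1" by (auto intro: unit)
    show "z1 \<noteq> z2" "z2 \<noteq> z3" "z3 \<noteq> z1" using simple[of z1] simple[of z2] simple[of z3] by auto
  qed (use s in auto)
qed

subsection \<open>The Euler center\<close>

lemma cross_eq_0_if_collinear:
  assumes "collinear {P, Q, R}"
  shows "cross (Q - P) (R - P) = 0"
proof -
  consider "P = R" | u where "Q = u *\<^sub>R P + (1 - u) *\<^sub>R R"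
    using assms unfolding collinear_3_expand by blast
  then show ?thesis
  proof cases
    case 1
    then show ?thesis by (simp add: cross_def)
  next
    case 2
    show ?thesis unfolding 2 by (simp add: cross_def algebra_simps)
  qed
qed

lemma cross_stretch_nonzero:
  assumes "a > 0" "b > 0" "norm z1 = 1" "norm z2 = 1" "norm z3 = 1" "z1 \<noteq> z2" "z2 \<noteq> z3" "z3 \<noteq> z1"
  shows "cross (stretch a b z2 - stretch a b z1) (stretch a b z3 - stretch a b z1) \<noteq> 0"
proof
  assume "cross (stretch a b z2 - stretch a b z1) (stretch a b z3 - stretch a b z1) = 0"
  then have "z3 + z1 * z2 * cnj z3 - (z1 + z2) = 0"
    using cross_stretch_sq[OF assms(3,4), of a b z3] assms by simp
  \<comment> \<open>Times \<open>z3\<close>, the chord equation at \<open>z3\<close> is this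
    product: a line meets the circle in no third point.\<close>
  then have "(z3 - z1) * (z3 - z2) = 0"
    using unit_cnj[OF assms(5)] by algebra
  then show False using assms by auto
qed

lemma orthogonal_to_basis_eq_0:
  assumes "cross u v \<noteq> 0" "w \<bullet> u = 0" "w \<bullet> v = (0::real)"
  shows "w = 0"
proof -
  have "cross u v * fst w = 0" "cross u v * snd w = 0"
    using assms(2,3) unfolding cross_def inner_prod_def inner_real_def by algebra+
  with assms(1) show ?thesis by (simp add: prod_eq_iff)
qed

lemma orthogonal_diff_if_equidistant:
  fixes N N' A B :: "'a :: real_inner"
  assumes "norm (N - A) = norm (N - B)" "norm (N' - A) = norm (N' - B)"
  shows "(N - N') \<bullet> (A - B) = 0"
proof -
  have "(N - A) \<bullet> (N - A) = (N - B) \<bullet> (N - B)" "(N' - A) \<bullet> (N' - A) = (N' - B) \<bullet> (N' - B)"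
    using assms by (simp_all add: norm_eq)
  then show ?thesis by (simp add: inner_commute algebra_simps)
qed

text \<open>\<open>K\<close> is the circumcenter, and this is Euler's relation
  \<open>H - K = (P - K) + (Q - K) + (R - K)\<close>. Two orthocenters would differ by a vector
  orthogonal to two independent sides.\<close>

lemma orthocenters_eq:
  assumes "cross (Q - P) (R - P) \<noteq> 0"
    and "norm (P - K) = norm (Q - K)" "norm (Q - K) = norm (R - K)"
  shows "orthocenters P Q R = {P + Q + R - 2 *\<^sub>R K}"
proof -
  have eq: "(P - K) \<bullet> (P - K) = (Q - K) \<bullet> (Q - K)" "(Q - K) \<bullet> (Q - K) = (R - K) \<bullet> (R - K)"
    using assms(2,3) by (simp_all add: norm_eq)
  let ?H = "P + Q + R - 2 *\<^sub>R K"
  have H: "?H \<in> orthocenters P Q R"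
    using eq unfolding orthocenters_def altitude_def
    by (auto simp: inner_commute algebra_simps inner_scaleR_left)
  moreover have "X = ?H" if "X \<in> orthocenters P Q R" for X
  proof -
    have "(X - ?H) \<bullet> (Q - P) = 0" "(X - ?H) \<bullet> (R - P) = 0"
      using that H unfolding orthocenters_def altitude_def
      by (simp_all add: inner_diff_left inner_diff_right)
    then have "X - ?H = 0" by (rule orthogonal_to_basis_eq_0[OF assms(1)])
    then show ?thesis by simp
  qed
  ultimately show ?thesis by blast
qed

lemma altitude_foot_on_nine_point_circle:
  assumes "D \<in> altitude_feet P Q R" "norm (Q - K) = norm (R - K)"
  shows "norm ((1/2) *\<^sub>R (P + Q + R - K) - D) = norm (P - K) / 2"
proof -
  obtain x where x: "D = Q + x *\<^sub>R (R - Q)" and perp: "(D - P) \<bullet> (Q - R) = 0"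
    using assms(1) unfolding altitude_feet_def altitude_def affine_hull_2_alt by auto
  let ?M = "(1/2) *\<^sub>R (Q + R)" and ?N = "(1/2) *\<^sub>R (P + Q + R - K)"
  have K: "(Q - K) \<bullet> (Q - K) = (R - K) \<bullet> (R - K)" using assms(2) by (simp add: norm_eq)
  have KM: "(K - ?M) \<bullet> (Q - R) = 0" using K by (simp add: inner_commute algebra_simps)
  have DM: "D - ?M = (1/2 - x) *\<^sub>R (Q - R)" by (simp add: x prod_eq_iff field_simps)
  \<comment> \<open>With \<open>u = (1/2) *\<^sub>R (P - K)\<close> and \<open>x = D - ?M\<close>
    this reads \<open>x \<bullet> (x - 2 *\<^sub>R u) = 0\<close>, so \<open>u - x\<close> and
    \<open>u\<close> have equal norms.\<close>
  have "(D - ?M) \<bullet> ((D - P) + (K - ?M)) = 0"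
    using perp KM unfolding DM by (simp add: inner_add_left inner_commute[of "Q - R"] inner_scaleR_left)
  moreover have "?N - D = (1/2) *\<^sub>R (P - K) - (D - ?M)" by (simp add: algebra_simps)
  ultimately have "(?N - D) \<bullet> (?N - D) = (1/2) *\<^sub>R (P - K) \<bullet> (1/2) *\<^sub>R (P - K)"
    by (simp add: inner_commute algebra_simps)
  then have "norm (?N - D) = norm ((1/2) *\<^sub>R (P - K))" by (simp only: norm_eq)
  then show ?thesis by simp
qed

text \<open>The side midpoints form a nondegenerate triangle and already determine \<open>N\<close>.
  The point halfway between the circumcenter \<open>K\<close> and the orthocenter is half the
  circumradius away from all nine points.\<close>

lemma is_euler_center_iff:
  assumes cr: "cross (Q - P) (R - P) \<noteq> 0"
    and PQ: "norm (P - K) = norm (Q - K)" and QR: "norm (Q - K) = norm (R - K)"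
  shows "is_euler_center N P Q R \<longleftrightarrow> N = (1/2) *\<^sub>R (P + Q + R - K)"
proof -
  let ?N = "(1/2) *\<^sub>R (P + Q + R - K)"
  have mid: "norm (?N - midpoint Q R) = norm (P - K) / 2" "norm (?N - midpoint R P) = norm (P - K) / 2"
    "norm (?N - midpoint P Q) = norm (P - K) / 2"
  proof -
    have "?N - midpoint Q R = (1/2) *\<^sub>R (P - K)" "?N - midpoint R P = (1/2) *\<^sub>R (Q - K)"
      "?N - midpoint P Q = (1/2) *\<^sub>R (R - K)"
      by (simp_all add: midpoint_def algebra_simps)
    then show "norm (?N - midpoint Q R) = norm (P - K) / 2" "norm (?N - midpoint R P) = norm (P - K) / 2"
      "norm (?N - midpoint P Q) = norm (P - K) / 2"
      using PQ QR by simp_all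
  qed
  show ?thesis
  proof
    assume "is_euler_center N P Q R"
    then obtain \<rho> where "nine_points P Q R \<subseteq> sphere N \<rho>" unfolding is_euler_center_def by blast
    then have "norm (N - midpoint Q R) = \<rho>" "norm (N - midpoint R P) = \<rho>" "norm (N - midpoint P Q) = \<rho>"
      unfolding nine_points_def by (auto simp: dist_norm)
    with mid have "(N - ?N) \<bullet> (midpoint Q R - midpoint R P) = 0" "(N - ?N) \<bullet> (midpoint Q R - midpoint P Q) = 0"
      by (intro orthogonal_diff_if_equidistant; simp)+
    then have "(N - ?N) \<bullet> (Q - P) = 0" "(N - ?N) \<bullet> (R - P) = 0"
      by (simp_all add: midpoint_def algebra_simps)
    then have "N - ?N = 0" by (rule orthogonal_to_basis_eq_0[OF cr])
    then show "N = ?N" by simp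
  next
    assume N: "N = ?N"
    have "norm (P - K) \<noteq> 0"
      using cr PQ QR by (auto simp: cross_def)
    then have pos: "norm (P - K) / 2 > 0" by simp
    have perm: "P + Q + R = Q + R + P" "P + Q + R = R + P + Q" by (simp_all add: algebra_simps)
    have feet: "norm (N - D) = norm (P - K) / 2"
      if D: "D \<in> altitude_feet P Q R \<union> altitude_feet Q R P \<union> altitude_feet R P Q" for D
    proof -
      consider "D \<in> altitude_feet P Q R" | "D \<in> altitude_feet Q R P" | "D \<in> altitude_feet R P Q"
        using D by blast
      then show ?thesis
      proof cases
        case 1
        then show ?thesis unfolding N by (rule altitude_foot_on_nine_point_circle[OF _ QR])
      next
        case 2
        then show ?thesis unfolding N perm(1) PQ
          using PQ QR by (intro altitude_foot_on_nine_point_circle) auto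
      next
        case 3
        then show ?thesis unfolding N perm(2) PQ QR
          using PQ QR by (intro altitude_foot_on_nine_point_circle) auto
      qed
    qed
    have orth: "norm (N - midpoint H V) = norm (P - K) / 2" if "H \<in> orthocenters P Q R" "V \<in> {P, Q, R}" for H V
    proof -
      have "H = P + Q + R - 2 *\<^sub>R K" using that(1) orthocenters_eq[OF assms] by simp
      then have "N - midpoint H V = (1/2) *\<^sub>R (K - V)"
        by (simp add: N midpoint_def algebra_simps) (simp add: prod_eq_iff)
      then have "norm (N - midpoint H V) = norm (V - K) / 2" by (simp add: norm_minus_commute)
      then show ?thesis using that(2) PQ QR by auto
    qed
    have "nine_points P Q R \<subseteq> sphere N (norm (P - K) / 2)"
      unfolding nine_points_def using mid[folded N] feet orth by (auto simp: dist_norm)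
    with pos show "is_euler_center N P Q R" unfolding is_euler_center_def by blast
  qed
qed

text \<open>
  The circle through the three points meets the ellipse in a fourth point, whose parameter is
  the conjugate of \<open>z1 * z2 * z3\<close>; its equation in the parameter \<open>z\<close> is a quartic with sum of
  roots \<open>4 * (a * u - \<i> * b * v) / (a\<^sup>2 - b\<^sup>2)\<close>, which gives the center \<open>(u, v)\<close>.
\<close>
lemma circumcenter_stretch:
  assumes "a > 0" "b > 0" "norm z1 = 1" "norm z2 = 1" "norm z3 = 1"
  defines "W \<equiv> z1 + z2 + z3 + cnj (z1 * z2 * z3)"
  defines "K \<equiv> ((a\<^sup>2 - b\<^sup>2) / (4 * a) * Re W, - (a\<^sup>2 - b\<^sup>2) / (4 * b) * Im W)"
  shows "norm (stretch a b z1 - K) = norm (stretch a b z2 - K)"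
    "norm (stretch a b z2 - K) = norm (stretch a b z3 - K)"
proof -
  have dist: "(norm (stretch a b z - K))\<^sup>2 =
      (norm K)\<^sup>2 + (a\<^sup>2 + b\<^sup>2) / 2 - (a\<^sup>2 - b\<^sup>2) / 2 * Re (z * W - z\<^sup>2)" if "norm z = 1" for z
  proof -
    have "(Re z)\<^sup>2 + (Im z)\<^sup>2 = 1" using that by (simp add: cmod_power2[symmetric])
    moreover have "a * ((a\<^sup>2 - b\<^sup>2) / (4 * a)) = (a\<^sup>2 - b\<^sup>2) / 4" "b * (- (a\<^sup>2 - b\<^sup>2) / (4 * b)) = - (a\<^sup>2 - b\<^sup>2) / 4"
      using assms by simp_all
    moreover have "(norm (stretch a b z - K))\<^sup>2 = (a * Re z - fst K)\<^sup>2 + (b * Im z - snd K)\<^sup>2"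
      "(norm K)\<^sup>2 = (fst K)\<^sup>2 + (snd K)\<^sup>2"
      unfolding power2_norm_eq_inner by (simp_all add: stretch_def inner_prod_def power2_eq_square)
    moreover have "fst K = (a\<^sup>2 - b\<^sup>2) / (4 * a) * Re W" "snd K = - (a\<^sup>2 - b\<^sup>2) / (4 * b) * Im W"
      by (simp_all add: K_def)
    moreover have "Re (z * W - z\<^sup>2) = Re z * Re W - Im z * Im W - ((Re z)\<^sup>2 - (Im z)\<^sup>2)"
      by (simp add: power2_eq_square)
    ultimately show ?thesis by algebra
  qed
  \<comment> \<open>Since \<open>z * cnj (z * x * y) = cnj (x * y)\<close>, only the product of the
    other two vertices gets conjugated, and the real part is symmetric in the three
    vertices.\<close>
  have conj: "Re (z * W - z\<^sup>2) = Re (z1 * z2 + z2 * z3 + z3 * z1)"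
    if "z = z1 \<and> x = z2 \<and> y = z3 \<or> z = z2 \<and> x = z3 \<and> y = z1 \<or> z = z3 \<and> x = z1 \<and> y = z2" for z x y
  proof -
    have zxy: "W = z + x + y + cnj (z * x * y)" "z1 * z2 + z2 * z3 + z3 * z1 = z * x + z * y + x * y"
      "norm z = 1"
      using that assms by (auto simp: algebra_simps)
    have "z * W - z\<^sup>2 = z * x + z * y + cnj (x * y)"
      using unit_cnj[OF zxy(3)] unfolding zxy(1) complex_cnj_mult by algebra
    then show ?thesis unfolding zxy(2) by simp
  qed
  have "(norm (stretch a b z1 - K))\<^sup>2 = (norm (stretch a b z2 - K))\<^sup>2"
    "(norm (stretch a b z2 - K))\<^sup>2 = (norm (stretch a b z3 - K))\<^sup>2"
    unfolding dist[OF assms(3)] dist[OF assms(4)] dist[OF assms(5)]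
    using conj[of z1 z2 z3] conj[of z2 z3 z1] conj[of z3 z1 z2] by simp_all
  then show "norm (stretch a b z1 - K) = norm (stretch a b z2 - K)"
    "norm (stretch a b z2 - K) = norm (stretch a b z3 - K)"
    by (simp_all add: power2_eq_iff_nonneg)
qed

text \<open>The center is half of the vertex sum minus the circumcenter; the latter depends only on
  the sum and the product of the parameters.\<close>

lemma euler_center_stretch_iff:
  assumes "a > 0" "b > 0" "norm z1 = 1" "norm z2 = 1" "norm z3 = 1" "z1 \<noteq> z2" "z2 \<noteq> z3" "z3 \<noteq> z1"
  shows "is_euler_center N (stretch a b z1) (stretch a b z2) (stretch a b z3) \<longleftrightarrow>
    N = (((3 * a\<^sup>2 + b\<^sup>2) * Re (z1 + z2 + z3) - (a\<^sup>2 - b\<^sup>2) * Re (z1 * z2 * z3)) / (8 * a),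
         ((a\<^sup>2 + 3 * b\<^sup>2) * Im (z1 + z2 + z3) - (a\<^sup>2 - b\<^sup>2) * Im (z1 * z2 * z3)) / (8 * b))"
proof -
  note cr = cross_stretch_nonzero[OF assms]
  note eq = is_euler_center_iff[OF cr circumcenter_stretch[OF assms(1-5)]]
  have S: "stretch a b z1 + stretch a b z2 + stretch a b z3 = stretch a b (z1 + z2 + z3)"
    by (simp add: stretch_def algebra_simps)
  define s l where "s = z1 + z2 + z3" and "l = z1 * z2 * z3"
  show ?thesis
    unfolding eq S s_def[symmetric] l_def[symmetric]
    unfolding stretch_def prod_eq_iff
    using assms(1,2) by (simp add: field_simps power2_eq_square)
qed

section \<open>Segments as degenerate ellipses\<close>

lemma ellipse_with_axes_closed_segment:
  "ellipse_with_axes (closed_segment C F) (dist C F) 0"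
proof -
  obtain u :: point where u: "norm u = 1" "F - C = dist C F *\<^sub>R u"
  proof (cases "C = F")
    case True
    then show ?thesis by (intro that[of "(1, 0)"]) (simp_all add: norm_prod_def zero_prod_def)
  next
    case False
    then show ?thesis
      by (intro that[of "(1 / dist C F) *\<^sub>R (F - C)"]) (simp_all add: dist_norm norm_minus_commute)
  qed
  have F: "F = C + dist C F *\<^sub>R u" using u(2) by (simp add: algebra_simps)
  obtain v :: point where v: "norm v = 1" "u \<bullet> v = 0"
    using u(1) by (intro that[of "(- snd u, fst u)"]) (simp_all add: norm_prod_def inner_prod_def add.commute)
  have "closed_segment C F = {midpoint C F + (dist C F / 2 * cos s) *\<^sub>R u + (0 / 2 * sin s) *\<^sub>R v | s. True}"
  proof -
    have pt: "C + x *\<^sub>R (F - C) = midpoint C F + (dist C F / 2 * (2 * x - 1)) *\<^sub>R u" for x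
    proof -
      have "C + x *\<^sub>R (F - C) = midpoint C F + ((2 * x - 1) / 2) *\<^sub>R (F - C)"
        by (simp add: midpoint_def prod_eq_iff field_simps)
      then show ?thesis unfolding u(2) by (simp add: mult.commute)
    qed
    have "X \<in> closed_segment C F \<longleftrightarrow> (\<exists>s. X = midpoint C F + (dist C F / 2 * cos s) *\<^sub>R u)" for X
    proof
      assume "X \<in> closed_segment C F"
      then obtain x where x: "0 \<le> x" "x \<le> 1" "X = C + x *\<^sub>R (F - C)"
        by (auto simp: in_segment algebra_simps)
      then have "X = midpoint C F + (dist C F / 2 * cos (arccos (2 * x - 1))) *\<^sub>R u"
        unfolding x(3) pt by simp
      then show "\<exists>s. X = midpoint C F + (dist C F / 2 * cos s) *\<^sub>R u" by blast
    next
      assume "\<exists>s. X = midpoint C F + (dist C F / 2 * cos s) *\<^sub>R u"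
      then obtain s where X: "X = midpoint C F + (dist C F / 2 * cos s) *\<^sub>R u" by blast
      obtain y where y: "y = cos s" "- 1 \<le> y" "y \<le> 1" by simp
      define x where "x = (1 + y) / 2"
      have "0 \<le> x" "x \<le> 1" using y(2,3) by (simp_all add: x_def)
      moreover have "X = C + x *\<^sub>R (F - C)"
        unfolding X pt y(1)[symmetric] by (simp add: x_def field_simps)
      ultimately show "X \<in> closed_segment C F"
        unfolding in_segment by (intro exI[of _ x]) (simp add: algebra_simps)
    qed
    then show ?thesis by auto
  qed
  with u(1) v have "\<exists>M u v. norm u = 1 \<and> norm v = 1 \<and> u \<bullet> v = 0 \<and> closed_segment C F =
      {M + (dist C F / 2 * cos s) *\<^sub>R u + (0 / 2 * sin s) *\<^sub>R v | s. True}"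
    by blast
  then show ?thesis unfolding ellipse_with_axes_def by (intro conjI zero_le_dist order_refl)
qed

subsection \<open>The Poncelet family\<close>

lemma inscribed_stretch_iff:
  assumes "a > 0" "b > 0"
  shows "inscribed_triangle a b P Q R \<longleftrightarrow> (\<exists>z1 z2 z3. norm z1 = 1 \<and> norm z2 = 1 \<and> norm z3 = 1 \<and>
    z1 \<noteq> z2 \<and> z2 \<noteq> z3 \<and> z3 \<noteq> z1 \<and> P = stretch a b z1 \<and> Q = stretch a b z2 \<and> R = stretch a b z3)"
    (is "_ \<longleftrightarrow> ?rhs")
proof
  assume *: "inscribed_triangle a b P Q R"
  then obtain z1 z2 z3 where z: "norm z1 = 1" "norm z2 = 1" "norm z3 = 1"
      "P = stretch a b z1" "Q = stretch a b z2" "R = stretch a b z3"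
    unfolding inscribed_triangle_def in_ellipse_iff[OF assms] by blast
  moreover have "z1 \<noteq> z2" "z2 \<noteq> z3" "z3 \<noteq> z1"
    using * z(4-6) unfolding inscribed_triangle_def by (auto simp: insert_commute)
  ultimately show ?rhs by blast
next
  assume ?rhs
  then show "inscribed_triangle a b P Q R"
    unfolding inscribed_triangle_def in_ellipse_iff[OF assms]
    using cross_stretch_nonzero[OF assms] cross_eq_0_if_collinear by blast
qed

text \<open>
  Fuss's relation between the radius \<open>r\<close> and the center \<^term>\<open>stretch a b w\<close> of a circle inscribed in
  the triangles of a Poncelet family.
\<close>
definition fuss :: "real \<Rightarrow> real \<Rightarrow> complex \<Rightarrow> real \<Rightarrow> bool" where
  "fuss a b w r \<longleftrightarrow> (norm (w\<^sup>2 + of_real (r\<^sup>2 / b\<^sup>2 - r\<^sup>2 / a\<^sup>2)))\<^sup>2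
     = 2 * (norm w)\<^sup>2 - 1 + 2 * (r\<^sup>2 / a\<^sup>2 + r\<^sup>2 / b\<^sup>2)"

text \<open>\<open>fuss\<close> is the vanishing of the factor in \<open>chord_form_of_vieta\<close>
  for \<open>p = 2 * w\<close>, a condition on the circle alone. The other two equations select the
  triples.\<close>

lemma tangent_triangle_iff:
  fixes a b r :: real and w z1 z2 z3 :: complex
  assumes "a > 0" "b > 0" "r \<ge> 0" "norm z1 = 1" "norm z2 = 1" "norm z3 = 1"
    "z1 \<noteq> z2" "z2 \<noteq> z3" "z3 \<noteq> z1"
  defines "C \<equiv> stretch a b w" and "q \<equiv> w\<^sup>2 + of_real (r\<^sup>2 / b\<^sup>2 - r\<^sup>2 / a\<^sup>2)"
  shows "line_tangent (stretch a b z1) (stretch a b z2) C r \<and>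
      line_tangent (stretch a b z2) (stretch a b z3) C r \<and>
      line_tangent (stretch a b z3) (stretch a b z1) C r \<longleftrightarrow>
    fuss a b w r \<and> z1 + z2 + z3 = 2 * w + z1 * z2 * z3 * cnj q \<and>
      z1 * z2 + z2 * z3 + z3 * z1 = q + z1 * z2 * z3 * cnj (2 * w)"
proof -
  define \<kappa> where "\<kappa> = complex_of_real (2 * ((norm w)\<^sup>2 - r\<^sup>2 / a\<^sup>2 - r\<^sup>2 / b\<^sup>2))"
  have fuss: "fuss a b w r \<longleftrightarrow> \<kappa> - (2 * w * cnj (2 * w) - q * cnj q - 1) = 0"
  proof -
    have "\<kappa> - (2 * w * cnj (2 * w) - q * cnj q - 1) =
      of_real ((norm q)\<^sup>2 - (2 * (norm w)\<^sup>2 - 1 + 2 * (r\<^sup>2 / a\<^sup>2 + r\<^sup>2 / b\<^sup>2)))"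
    proof -
      have "w * cnj w = of_real ((norm w)\<^sup>2)" "q * cnj q = of_real ((norm q)\<^sup>2)"
        by (rule complex_norm_square[symmetric])+
      then show ?thesis unfolding \<kappa>_def complex_cnj_mult complex_cnj_numeral
        by (simp add: algebra_simps)
    qed
    then show ?thesis unfolding fuss_def q_def[symmetric] by (simp only: of_real_eq_0_iff) auto
  qed
  note tangent = line_tangent_stretch_iff[OF assms(1-3), where w = w, folded C_def q_def \<kappa>_def]
  have z0: "z1 * z2 \<noteq> 0" "z2 * z3 \<noteq> 0" "z3 * z1 \<noteq> 0" using assms(4-6) by auto
  have perm: "z2 + z3 + z1 = z1 + z2 + z3" "z3 + z1 + z2 = z1 + z2 + z3"
    "z2 * z3 * z1 = z1 * z2 * z3" "z3 * z1 * z2 = z1 * z2 * z3"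
    "z2 * z3 + z3 * z1 + z1 * z2 = z1 * z2 + z2 * z3 + z3 * z1"
    "z3 * z1 + z1 * z2 + z2 * z3 = z1 * z2 + z2 * z3 + z3 * z1"
    by (simp_all add: ac_simps)
  show ?thesis
    unfolding tangent[OF assms(4,5,7)] tangent[OF assms(5,6,8)] tangent[OF assms(6,4,9)] fuss
  proof (intro iffI conjI; elim conjE)
    assume c: "chord_form (2 * w) q \<kappa> z1 z2 = 0" "chord_form (2 * w) q \<kappa> z2 z3 = 0" "chord_form (2 * w) q \<kappa> z3 z1 = 0"
    show v: "z1 + z2 + z3 = 2 * w + z1 * z2 * z3 * cnj q"
      "z1 * z2 + z2 * z3 + z3 * z1 = q + z1 * z2 * z3 * cnj (2 * w)"
      by (rule chord_forms_imp_vieta[OF c assms(7-9)])+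
    show "\<kappa> - (2 * w * cnj (2 * w) - q * cnj q - 1) = 0"
      using chord_form_of_vieta[OF v, of \<kappa>] c(1) z0(1) by simp
  next
    assume k: "\<kappa> - (2 * w * cnj (2 * w) - q * cnj q - 1) = 0"
      and v: "z1 + z2 + z3 = 2 * w + z1 * z2 * z3 * cnj q"
      "z1 * z2 + z2 * z3 + z3 * z1 = q + z1 * z2 * z3 * cnj (2 * w)"
    show "chord_form (2 * w) q \<kappa> z1 z2 = 0"
      using chord_form_of_vieta[OF v, of \<kappa>] k by simp
    show "chord_form (2 * w) q \<kappa> z2 z3 = 0"
      using chord_form_of_vieta[of z2 z3 z1 "2 * w" q \<kappa>, unfolded perm, OF v] k by simp
    show "chord_form (2 * w) q \<kappa> z3 z1 = 0"
      using chord_form_of_vieta[of z3 z1 z2 "2 * w" q \<kappa>, unfolded perm, OF v] k by simp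
  qed
qed

text \<open>The highest and lowest points of the circle lie inside the ellipse; adding their two
  inequalities cancels the term linear in \<open>Im w\<close>.\<close>

lemma nested_circle_radius:
  assumes "a > 0" "b > 0" "r \<ge> 0" "sphere (stretch a b w) r \<subseteq> ellipse_inside a b"
  shows "r\<^sup>2 / b\<^sup>2 < 1 - (norm w)\<^sup>2"
proof -
  have "(a * Re w, b * Im w + s * r) \<in> ellipse_inside a b" if "s \<in> {1, -1}" for s
  proof -
    have "dist (stretch a b w) (a * Re w, b * Im w + s * r) = r"
      using that assms(3) by (auto simp: stretch_def dist_norm norm_prod_def)
    then show ?thesis using assms(4) by auto
  qed
  then have "(Re w)\<^sup>2 + (Im w + s * r / b)\<^sup>2 < 1" if "s \<in> {1, -1}" for s
  proof -
    have "(a * Re w)\<^sup>2 / a\<^sup>2 = (Re w)\<^sup>2" "(b * Im w + s * r)\<^sup>2 / b\<^sup>2 = (Im w + s * r / b)\<^sup>2"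
      using assms(1,2) by (simp_all add: power_mult_distrib flip: power_divide) (simp add: add_divide_distrib)
    with \<open>\<And>s. s \<in> {1, -1} \<Longrightarrow> (a * Re w, b * Im w + s * r) \<in> ellipse_inside a b\<close>[OF that]
    show ?thesis by (simp add: ellipse_inside_def)
  qed
  from this[of 1] this[of "-1"] have "(Re w)\<^sup>2 + (Im w + r / b)\<^sup>2 < 1" "(Re w)\<^sup>2 + (Im w - r / b)\<^sup>2 < 1"
    by simp_all
  then show ?thesis unfolding cmod_power2 power_divide[symmetric] power2_sum power2_diff by linarith
qed

text \<open>
  Fuss's relation is quadratic in \<open>r\<^sup>2\<close>, and the product of its two roots is too large for both
  circles to be nested.
\<close>
lemma nested_fuss_radius_unique:
  assumes "0 < b" "b < a" "0 < r" "0 < r'"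
    and "sphere (stretch a b w) r \<subseteq> ellipse_inside a b" "sphere (stretch a b w) r' \<subseteq> ellipse_inside a b"
    and "fuss a b w r" "fuss a b w r'"
  shows "r = r'"
proof (rule ccontr)
  assume ne: "r \<noteq> r'"
  define d n where "d = b\<^sup>2 / a\<^sup>2" and "n = 1 - (norm w)\<^sup>2"
  have a: "a > 0" using assms by simp
  have d: "0 < d" "d < 1" using assms a by (simp_all add: d_def power_strict_mono)
  have quad: "(1 - d)\<^sup>2 * (s\<^sup>2 / b\<^sup>2)\<^sup>2 + (2 * (1 - d) * Re (w\<^sup>2) - 2 * (1 + d)) * (s\<^sup>2 / b\<^sup>2) + n\<^sup>2 = 0"
    if "fuss a b w s" for s
  proof -
    define \<rho> where "\<rho> = s\<^sup>2 / b\<^sup>2"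
    have s: "s\<^sup>2 / a\<^sup>2 = d * \<rho>" using assms a by (simp add: d_def \<rho>_def)
    have "(norm (w\<^sup>2 + of_real (\<rho> - d * \<rho>)))\<^sup>2 = 2 * (norm w)\<^sup>2 - 1 + 2 * (d * \<rho> + \<rho>)"
      using that unfolding fuss_def \<rho>_def[symmetric] s .
    moreover have "(norm (w\<^sup>2 + of_real (\<rho> - d * \<rho>)))\<^sup>2 = ((norm w)\<^sup>2)\<^sup>2 + 2 * (\<rho> - d * \<rho>) * Re (w\<^sup>2) + (\<rho> - d * \<rho>)\<^sup>2"
      unfolding cmod_power2 by (simp add: power2_eq_square algebra_simps)
    ultimately show ?thesis unfolding \<rho>_def[symmetric] n_def by algebra
  qed
  define \<rho> \<rho>' where "\<rho> = r\<^sup>2 / b\<^sup>2" and "\<rho>' = r'\<^sup>2 / b\<^sup>2"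
  have pos: "0 < \<rho>" "0 < \<rho>'" using assms by (simp_all add: \<rho>_def \<rho>'_def)
  have lt: "\<rho> < n" "\<rho>' < n"
    using nested_circle_radius[of a b r w] nested_circle_radius[of a b r' w] assms a
    by (simp_all add: \<rho>_def \<rho>'_def n_def)
  have "\<rho> \<noteq> \<rho>'" using ne assms by (simp add: \<rho>_def \<rho>'_def power2_eq_iff_nonneg)
  \<comment> \<open>Eliminating the linear coefficient from the two quadratic equations gives the
    product of the distinct roots.\<close>
  moreover have "(\<rho> - \<rho>') * ((1 - d)\<^sup>2 * (\<rho> * \<rho>') - n\<^sup>2) = 0"
    using quad[OF assms(7)] quad[OF assms(8)] unfolding \<rho>_def[symmetric] \<rho>'_def[symmetric]
    by algebra
  ultimately have "n\<^sup>2 = (1 - d)\<^sup>2 * (\<rho> * \<rho>')" by simp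
  also have "\<dots> \<le> \<rho> * \<rho>'"
    using d pos by (intro mult_left_le_one_le) (auto simp: abs_square_le_1)
  also have "\<dots> < n\<^sup>2" unfolding power2_eq_square using pos lt by (intro mult_strict_mono) auto
  finally show False by simp
qed

text \<open>Since \<open>norm (f * g) = norm w\<close>, the product of
  \<open>1 - (norm f)\<^sup>2\<close> and \<open>1 - (norm g)\<^sup>2\<close> is
  \<open>1 - (norm w)\<^sup>2 - 2 * k > 0\<close>. Their sum is positive too, hence so are
  both.\<close>

lemma foci_in_disc:
  fixes w :: complex
  assumes "k \<ge> 0" "norm (w\<^sup>2 + of_real k) = norm w" "(norm w)\<^sup>2 + 2 * k < 1"
  obtains f g where "norm f < 1" "norm g < 1" "f + g = 2 * w" "f * g = w\<^sup>2 + of_real k"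
proof -
  define f g where "f = w + \<i> * of_real (sqrt k)" and "g = w - \<i> * of_real (sqrt k)"
  have fg: "f + g = 2 * w" by (simp add: f_def g_def)
  have prod: "f * g = w\<^sup>2 + of_real k"
    using assms(1) by (simp add: f_def g_def power2_eq_square algebra_simps flip: of_real_mult)
  have sum: "(norm f)\<^sup>2 + (norm g)\<^sup>2 = 2 * (norm w)\<^sup>2 + 2 * k"
    using assms(1) unfolding cmod_power2 f_def g_def by (simp add: power2_sum power2_diff)
  have "norm f * norm g = norm w" using assms(2) prod by (metis norm_mult)
  then have "(norm f)\<^sup>2 * (norm g)\<^sup>2 = (norm w)\<^sup>2" by (metis power_mult_distrib)
  then have "(1 - (norm f)\<^sup>2) * (1 - (norm g)\<^sup>2) = 1 - (norm w)\<^sup>2 - 2 * k"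
    using sum by (simp add: algebra_simps)
  then have "(1 - (norm f)\<^sup>2) * (1 - (norm g)\<^sup>2) > 0" using assms(3) by linarith
  moreover have "(1 - (norm f)\<^sup>2) + (1 - (norm g)\<^sup>2) > 0" using sum assms(1,3) by linarith
  ultimately have "1 - (norm f)\<^sup>2 > 0" "1 - (norm g)\<^sup>2 > 0"
    by (auto simp: zero_less_mult_iff)
  then have "norm f < 1" "norm g < 1" by (simp_all add: abs_square_less_1)
  then show thesis using that fg prod by blast
qed

subsection \<open>Families containing an equilateral triangle\<close>

text \<open>
  The centers of the families containing an equilateral triangle, written as
  \<open>C = ((a\<^sup>2 - b\<^sup>2) a X, (a\<^sup>2 - b\<^sup>2) b Y)\<close>.
\<close>
locale equilateral_center =
  fixes a b X Y :: real
  assumes b_pos: "0 < b" and b_less: "b < a"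
    and XY: "((a\<^sup>2 + 3 * b\<^sup>2) * X)\<^sup>2 + ((3 * a\<^sup>2 + b\<^sup>2) * Y)\<^sup>2 = 1"
begin

definition w :: complex where "w = of_real (a\<^sup>2 - b\<^sup>2) * Complex X Y"

text \<open>At an equilateral triangle the centroid and the circumcenter are both \<open>C\<close>,
  so the parameters have sum \<open>3 * w\<close>, and \<open>circumcenter_stretch\<close> gives
  \<open>3 * w + cnj l = 4 * Complex (a\<^sup>2 * X) (- b\<^sup>2 * Y)\<close>. Solving for
  \<open>l\<close> yields \<open>v\<close>.\<close>

definition v :: complex where "v = Complex ((a\<^sup>2 + 3 * b\<^sup>2) * X) ((3 * a\<^sup>2 + b\<^sup>2) * Y)"

definition G :: real where "G = b\<^sup>2 * X\<^sup>2 + a\<^sup>2 * Y\<^sup>2"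

text \<open>The radius for which \<open>r\<^sup>2 / b\<^sup>2 - r\<^sup>2 / a\<^sup>2\<close> equals
  \<open>cnj w * v - w\<^sup>2\<close>, which is the real number
  \<open>4 * (a\<^sup>2 - b\<^sup>2) * G\<close>.\<close>

definition r :: real where "r = 2 * a * b * sqrt G"

lemma a_pos: "0 < a" using b_pos b_less by simp

lemma e_pos: "0 < a\<^sup>2 - b\<^sup>2" using b_pos b_less by (simp add: power_strict_mono)

lemma norm_v: "norm v = 1" using XY by (simp add: v_def cmod_def)

lemma G_pos: "0 < G"
proof -
  have "X \<noteq> 0 \<or> Y \<noteq> 0" using XY by auto
  then show ?thesis using a_pos b_pos unfolding G_def
    by (auto intro: add_pos_nonneg add_nonneg_pos)
qed

lemma r_pos: "0 < r" using a_pos b_pos G_pos by (simp add: r_def)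

lemma r_sq: "r\<^sup>2 = 4 * a\<^sup>2 * b\<^sup>2 * G" "r\<^sup>2 / a\<^sup>2 = 4 * b\<^sup>2 * G" "r\<^sup>2 / b\<^sup>2 = 4 * a\<^sup>2 * G"
  using G_pos a_pos b_pos by (simp_all add: r_def power_mult_distrib)

lemma norm_w_sq: "(norm w)\<^sup>2 = 1 - 8 * (a\<^sup>2 + b\<^sup>2) * G"
  using XY unfolding w_def norm_mult G_def cmod_def power_mult_distrib
  by (simp add: power_mult_distrib) algebra

text \<open>With \<open>q\<close> the product of the foci, the equilateral triangle has
  \<open>3 * w = 2 * w + v * cnj q\<close>, which suggests \<open>q = cnj w * v\<close>; the
  coordinates confirm it.\<close>

lemma foci_product: "w\<^sup>2 + of_real (r\<^sup>2 / b\<^sup>2 - r\<^sup>2 / a\<^sup>2) = cnj w * v"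
  unfolding r_sq(2,3) by (simp add: complex_eq_iff w_def v_def G_def power2_eq_square) algebra

text \<open>As \<open>norm v = 1\<close>, the product of the foci has modulus \<open>norm w\<close>,
  and Fuss's relation reduces to \<open>norm_w_sq\<close>.\<close>

lemma fuss_r: "fuss a b w r"
  unfolding fuss_def foci_product norm_mult norm_v using norm_w_sq
  unfolding r_sq(2,3) by (simp add: algebra_simps)

lemma nested: "sphere (stretch a b w) r \<subseteq> ellipse_inside a b"
proof
  fix P assume "P \<in> sphere (stretch a b w) r"
  define h k where "h = fst P - a * (a\<^sup>2 - b\<^sup>2) * X" and "k = snd P - b * (a\<^sup>2 - b\<^sup>2) * Y"
  have P: "fst P = a * (a\<^sup>2 - b\<^sup>2) * X + h" "snd P = b * (a\<^sup>2 - b\<^sup>2) * Y + k"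
    by (simp_all add: h_def k_def)
  have "norm (P - stretch a b w) = r"
    using \<open>P \<in> sphere (stretch a b w) r\<close> by (simp add: dist_norm norm_minus_commute)
  moreover have "P - stretch a b w = (h, k)"
    by (simp add: prod_eq_iff stretch_def w_def h_def k_def)
  ultimately have hk: "h\<^sup>2 + k\<^sup>2 = r\<^sup>2" by (simp add: norm_prod_def flip: real_sqrt_pow2_iff) (metis real_sqrt_pow2 sum_power2_ge_zero)
  \<comment> \<open>Cauchy-Schwarz for \<open>(h, k)\<close> and
    \<open>(2 * a * b * (b * X), 2 * a * b * (a * Y))\<close>, both of length
    \<open>r\<close>.\<close>
  have cs: "4 * a * b * (b * X * h + a * Y * k) \<le> 2 * r\<^sup>2"
  proof -
    have "0 \<le> (2 * a * b * (b * X) - h)\<^sup>2 + (2 * a * b * (a * Y) - k)\<^sup>2" by simp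
    also have "\<dots> = r\<^sup>2 + (h\<^sup>2 + k\<^sup>2) - 4 * a * b * (b * X * h + a * Y * k)"
      unfolding r_sq(1) G_def by algebra
    finally show ?thesis using hk by simp
  qed
  have "(a\<^sup>2 * b\<^sup>2) * (norm w)\<^sup>2 + 2 * (a\<^sup>2 - b\<^sup>2) * a * b * (b * X * h + a * Y * k) + b\<^sup>2 * h\<^sup>2 + a\<^sup>2 * k\<^sup>2 < a\<^sup>2 * b\<^sup>2"
  proof -
    have "(a\<^sup>2 - b\<^sup>2) * (4 * a * b * (b * X * h + a * Y * k)) \<le> (a\<^sup>2 - b\<^sup>2) * (2 * r\<^sup>2)"
      using cs e_pos by (intro mult_left_mono) auto
    moreover have "b\<^sup>2 * h\<^sup>2 + a\<^sup>2 * k\<^sup>2 \<le> a\<^sup>2 * r\<^sup>2"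
    proof -
      have "b\<^sup>2 * h\<^sup>2 \<le> a\<^sup>2 * h\<^sup>2" using e_pos by (intro mult_right_mono) auto
      then show ?thesis unfolding hk[symmetric] by (simp add: algebra_simps)
    qed
    moreover have "(a\<^sup>2 * b\<^sup>2) * (norm w)\<^sup>2 = a\<^sup>2 * b\<^sup>2 - 2 * (a\<^sup>2 + b\<^sup>2) * r\<^sup>2"
      unfolding norm_w_sq r_sq(1) by algebra
    \<comment> \<open>The terms are the bounds for the constant, linear and quadratic parts in
      \<open>(h, k)\<close>; a margin of \<open>3 * b\<^sup>2 * r\<^sup>2\<close> remains.\<close>
    moreover have "a\<^sup>2 * b\<^sup>2 - 2 * (a\<^sup>2 + b\<^sup>2) * r\<^sup>2 + (a\<^sup>2 - b\<^sup>2) * r\<^sup>2 + a\<^sup>2 * r\<^sup>2 = a\<^sup>2 * b\<^sup>2 - 3 * b\<^sup>2 * r\<^sup>2"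
      by algebra
    moreover have "3 * b\<^sup>2 * r\<^sup>2 > 0" using b_pos r_pos by simp
    ultimately show ?thesis by (simp add: algebra_simps)
  qed
  moreover have "b\<^sup>2 * (fst P)\<^sup>2 + a\<^sup>2 * (snd P)\<^sup>2 = (a\<^sup>2 * b\<^sup>2) * (norm w)\<^sup>2
      + 2 * (a\<^sup>2 - b\<^sup>2) * a * b * (b * X * h + a * Y * k) + b\<^sup>2 * h\<^sup>2 + a\<^sup>2 * k\<^sup>2"
    unfolding P cmod_power2 by (simp add: w_def) algebra
  ultimately have "(fst P)\<^sup>2 / a\<^sup>2 + (snd P)\<^sup>2 / b\<^sup>2 < 1"
    using a_pos b_pos by (simp add: field_simps)
  then show "P \<in> ellipse_inside a b" by (auto simp: ellipse_inside_def)
qed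

text \<open>
  The Euler center of the triangle with \<open>z1 * z2 * z3 = l\<close>; the equilateral triangle has \<open>l = v\<close>.
\<close>
definition center_at :: "complex \<Rightarrow> point" where
  "center_at l = (((3 * a\<^sup>2 + b\<^sup>2) * Re (2 * w + l * (w * cnj v)) - (a\<^sup>2 - b\<^sup>2) * Re l) / (8 * a),
         ((a\<^sup>2 + 3 * b\<^sup>2) * Im (2 * w + l * (w * cnj v)) - (a\<^sup>2 - b\<^sup>2) * Im l) / (8 * b))"

text \<open>The family leaves the radius open, but \<open>nested_fuss_radius_unique\<close> forces
  it to be \<open>r\<close>. Conversely the foci lie in the disc, so every unit \<open>l\<close> is
  the product of the vertex parameters of some triangle.\<close>

lemma euler_center_locus_eq:
  "euler_center_locus a b (stretch a b w) = center_at ` sphere 0 1"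
proof (intro equalityI subsetI)
  fix N assume "N \<in> euler_center_locus a b (stretch a b w)"
  then obtain P Q R s where N: "is_euler_center N P Q R" and "inscribed_triangle a b P Q R"
    and s: "s > 0" "sphere (stretch a b w) s \<subseteq> ellipse_inside a b"
    and t: "line_tangent P Q (stretch a b w) s \<and> line_tangent Q R (stretch a b w) s
      \<and> line_tangent R P (stretch a b w) s"
    unfolding euler_center_locus_def poncelet_family_def by blast
  then obtain z1 z2 z3 where z: "norm z1 = 1" "norm z2 = 1" "norm z3 = 1" "z1 \<noteq> z2" "z2 \<noteq> z3" "z3 \<noteq> z1"
    and PQR: "P = stretch a b z1" "Q = stretch a b z2" "R = stretch a b z3"
    unfolding inscribed_stretch_iff[OF a_pos b_pos] by blast
  have vieta: "fuss a b w s" "z1 + z2 + z3 = 2 * w + z1 * z2 * z3 * cnj (w\<^sup>2 + of_real (s\<^sup>2 / b\<^sup>2 - s\<^sup>2 / a\<^sup>2))"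
    using t s(1) unfolding PQR by (subst (asm) tangent_triangle_iff; simp add: a_pos b_pos z)+
  have "s = r"
    by (rule nested_fuss_radius_unique[OF b_pos b_less s(1) r_pos s(2) nested vieta(1) fuss_r])
  then have "z1 + z2 + z3 = 2 * w + z1 * z2 * z3 * (w * cnj v)"
    using vieta(2) by (simp only: foci_product complex_cnj_mult complex_cnj_cnj)
  then have "N = center_at (z1 * z2 * z3)"
    using N unfolding PQR euler_center_stretch_iff[OF a_pos b_pos z] center_at_def by simp
  then show "N \<in> center_at ` sphere 0 1" using z by (auto simp: norm_mult)
next
  fix N assume "N \<in> center_at ` sphere 0 1"
  then obtain l where l: "norm l = 1" "N = center_at l" by auto
  define k where "k = r\<^sup>2 / b\<^sup>2 - r\<^sup>2 / a\<^sup>2"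
  have k: "k = 4 * (a\<^sup>2 - b\<^sup>2) * G" unfolding k_def r_sq(2,3) by (simp add: algebra_simps)
  have wk: "w\<^sup>2 + of_real k = cnj w * v" unfolding k_def by (rule foci_product)
  obtain f g where fg: "norm f < 1" "norm g < 1" "f + g = 2 * w" "f * g = w\<^sup>2 + of_real k"
  proof (rule foci_in_disc[of k w])
    show "0 \<le> k" using e_pos G_pos unfolding k by simp
    show "norm (w\<^sup>2 + of_real k) = norm w" unfolding wk by (simp add: norm_mult norm_v)
    have "(norm w)\<^sup>2 + 2 * k = 1 - 16 * b\<^sup>2 * G" unfolding norm_w_sq k by algebra
    also have "\<dots> < 1" using b_pos G_pos by simp
    finally show "(norm w)\<^sup>2 + 2 * k < 1" .
  qed (use that in blast)
  obtain z1 z2 z3 where z: "norm z1 = 1" "norm z2 = 1" "norm z3 = 1" "z1 \<noteq> z2" "z2 \<noteq> z3" "z3 \<noteq> z1"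
    and l': "z1 * z2 * z3 = l" and e1: "z1 + z2 + z3 = 2 * w + l * cnj (w\<^sup>2 + of_real k)"
    and e2: "z1 * z2 + z2 * z3 + z3 * z1 = w\<^sup>2 + of_real k + l * cnj (2 * w)"
    by (rule blaschke_triple_exists[OF fg(1,2) l(1), unfolded fg(3,4)])
  have "line_tangent (stretch a b z1) (stretch a b z2) (stretch a b w) r \<and>
      line_tangent (stretch a b z2) (stretch a b z3) (stretch a b w) r \<and>
      line_tangent (stretch a b z3) (stretch a b z1) (stretch a b w) r"
    unfolding tangent_triangle_iff[OF a_pos b_pos less_imp_le[OF r_pos] z] l' k_def[symmetric]
    using fuss_r e1 e2 by blast
  moreover have "inscribed_triangle a b (stretch a b z1) (stretch a b z2) (stretch a b z3)"
    unfolding inscribed_stretch_iff[OF a_pos b_pos] using z by blast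
  ultimately have "(stretch a b z1, stretch a b z2, stretch a b z3) \<in> poncelet_family a b (stretch a b w)"
    unfolding poncelet_family_def using r_pos nested by blast
  moreover have "is_euler_center N (stretch a b z1) (stretch a b z2) (stretch a b z3)"
    unfolding euler_center_stretch_iff[OF a_pos b_pos z] l(2) center_at_def l' e1 wk
    by simp
  ultimately show "N \<in> euler_center_locus a b (stretch a b w)"
    unfolding euler_center_locus_def by blast
qed

text \<open>The terms with \<^term>\<open>Im m\<close> cancel: this is the collapse of the minor axis.\<close>
lemma center_at_mult:
  "center_at (m * v) = ((1 + Re m) / 2) *\<^sub>R stretch a b w + ((1 - Re m) / 2) *\<^sub>R
     ((a^4 - b^4) * X / (2 * a), (a^4 - b^4) * Y / (2 * b))"
proof -
  have cancel: "m * v * (w * cnj v) = m * w"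
    using unit_cnj[OF norm_v] by algebra
  have center: "center_at (m * v) = (((3 * a\<^sup>2 + b\<^sup>2) * Re (2 * w + m * w) - (a\<^sup>2 - b\<^sup>2) * Re (m * v)) / (8 * a),
         ((a\<^sup>2 + 3 * b\<^sup>2) * Im (2 * w + m * w) - (a\<^sup>2 - b\<^sup>2) * Im (m * v)) / (8 * b))"
    unfolding center_at_def cancel ..
  \<comment> \<open>In the first coordinate \<open>m * w\<close> and \<open>m * v\<close> both
    contribute \<open>(3 * a\<^sup>2 + b\<^sup>2) * (a\<^sup>2 - b\<^sup>2) * Y * Im m\<close>, with
    opposite signs; the second coordinate is analogous with
    \<open>(a\<^sup>2 + 3 * b\<^sup>2) * X\<close>.\<close>
  have num: "(3 * a\<^sup>2 + b\<^sup>2) * Re (2 * w + m * w) - (a\<^sup>2 - b\<^sup>2) * Re (m * v)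
      = 4 * a\<^sup>2 * (1 + Re m) * ((a\<^sup>2 - b\<^sup>2) * X) + 2 * (1 - Re m) * ((a^4 - b^4) * X)"
    "(a\<^sup>2 + 3 * b\<^sup>2) * Im (2 * w + m * w) - (a\<^sup>2 - b\<^sup>2) * Im (m * v)
      = 4 * b\<^sup>2 * (1 + Re m) * ((a\<^sup>2 - b\<^sup>2) * Y) + 2 * (1 - Re m) * ((a^4 - b^4) * Y)"
    by (simp_all add: w_def v_def; algebra)+
  have div: "(4 * s\<^sup>2 * x * p + 2 * y * q) / (8 * s) = x / 2 * (s * p) + y / 2 * (q / (2 * s))"
    if "s > 0" for s x y p q :: real
    using that by (simp add: field_simps power2_eq_square)
  show ?thesis
    unfolding center num div[OF a_pos] div[OF b_pos] stretch_def by (simp add: w_def)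
qed

text \<open>Multiplication by \<open>v\<close> permutes the unit circle, and \<open>Re m\<close>
  sweeps the interval from -1 to 1. The end \<open>m = 1\<close> gives \<open>C\<close>, and
  \<open>m = -1\<close> gives the other endpoint.\<close>

lemma euler_center_locus_segment:
  "euler_center_locus a b (stretch a b w) =
     closed_segment (stretch a b w) ((a^4 - b^4) * X / (2 * a), (a^4 - b^4) * Y / (2 * b))"
    (is "_ = closed_segment ?C ?F")
proof -
  have "center_at ` sphere 0 1 = (\<lambda>m. center_at (m * v)) ` sphere 0 1"
  proof -
    have "(\<lambda>m. m * v) ` sphere 0 1 = sphere 0 1"
    proof (intro equalityI subsetI)
      fix l :: complex assume "l \<in> sphere 0 1"
      moreover have "l = l * cnj v * v" using unit_cnj[OF norm_v] by (simp add: mult_ac)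
      ultimately show "l \<in> (\<lambda>m. m * v) ` sphere 0 1"
        using norm_v by (intro image_eqI[of _ _ "l * cnj v"]) (auto simp: norm_mult)
    qed (auto simp: norm_mult norm_v)
    then show ?thesis by (metis image_image)
  qed
  also have "\<dots> = closed_segment ?C ?F"
  proof (intro equalityI subsetI)
    fix N assume "N \<in> (\<lambda>m. center_at (m * v)) ` sphere 0 1"
    then obtain m where "norm m = 1" and N: "N = center_at (m * v)" by auto
    then have "\<bar>Re m\<bar> \<le> 1" using abs_Re_le_cmod[of m] by simp
    then show "N \<in> closed_segment ?C ?F"
      unfolding N center_at_mult in_segment
      by (intro exI[of _ "(1 - Re m) / 2"]) (simp add: field_simps abs_le_iff)
  next
    fix N assume "N \<in> closed_segment ?C ?F"
    then obtain x where x: "0 \<le> x" "x \<le> 1" "N = (1 - x) *\<^sub>R ?C + x *\<^sub>R ?F"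
      unfolding in_segment by blast
    define m where "m = cis (arccos (1 - 2 * x))"
    have "Re m = 1 - 2 * x" using x by (simp add: m_def)
    then have "N = center_at (m * v)" unfolding center_at_mult x(3) by simp
    then show "N \<in> (\<lambda>m. center_at (m * v)) ` sphere 0 1" by (auto simp: m_def)
  qed
  finally show ?thesis unfolding euler_center_locus_eq .
qed

end

section \<open>The segment in terms of the angle \<open>t\<close>, and its length\<close>

theorem proposition14:
  fixes a b c t aE bE :: real and C F :: point
  assumes "0 < b" and "b < a" and "c\<^sup>2 = a\<^sup>2 - b\<^sup>2"
    and "aE = a * c\<^sup>2 / (a\<^sup>2 + 3 * b\<^sup>2)"
    and "bE = b * c\<^sup>2 / (3 * a\<^sup>2 + b\<^sup>2)"
    and "C = (aE * cos t, bE * sin t)"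
    and "F = ((a^4 - b^4) * cos t / (2 * (a^3 + 3 * a * b^2)),
              (a^4 - b^4) * sin t / (2 * (3 * a^2 * b + b^3)))"
  shows "\<exists>l5. ellipse_with_axes (euler_center_locus a b C) l5 0
       \<and> euler_center_locus a b C = closed_segment C F
       \<and> dist C F = l5
       \<and> l5\<^sup>2 = c^8 * (a^6 + 15 * a^4 * b^2 + 15 * a^2 * b^4 + b^6 - c^6 * cos (2 * t))
                / (8 * (3 * a^5 * b + 10 * a^3 * b^3 + 3 * a * b^5)^2)"
proof -
  define A B where "A = a\<^sup>2 + 3 * b\<^sup>2" and "B = 3 * a\<^sup>2 + b\<^sup>2"
  have a: "0 < a" using assms by simp
  have AB: "0 < A" "0 < B" using a assms(1) by (simp_all add: A_def B_def add_pos_pos)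
  \<comment> \<open>With this choice the locale assumption \<open>XY\<close> is
    \<open>(cos t)\<^sup>2 + (sin t)\<^sup>2 = 1\<close>.\<close>
  define X Y where "X = cos t / A" and "Y = sin t / B"
  interpret equilateral_center a b X Y
    by unfold_locales (use assms AB in \<open>simp_all add: X_def Y_def A_def[symmetric] B_def[symmetric]\<close>)
  have C': "C = (a * ((a\<^sup>2 - b\<^sup>2) * X), b * ((a\<^sup>2 - b\<^sup>2) * Y))"
    unfolding assms by (simp add: X_def Y_def A_def B_def)
  then have C: "C = stretch a b w" by (simp add: stretch_def w_def)
  have F: "F = ((a^4 - b^4) * X / (2 * a), (a^4 - b^4) * Y / (2 * b))"
    using assms a by (simp add: X_def Y_def A_def B_def power2_eq_square power3_eq_cube algebra_simps)
  have locus: "euler_center_locus a b C = closed_segment C F"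
    unfolding C F by (rule euler_center_locus_segment)
  \<comment> \<open>Both coordinates of \<open>C - F\<close> contain
    \<open>a\<^sup>2 - b\<^sup>2\<close> twice, because \<open>a^4 - b^4\<close> contributes
    \<open>a\<^sup>2 + b\<^sup>2\<close> against \<open>2 * a\<^sup>2\<close> or
    \<open>2 * b\<^sup>2\<close>.\<close>
  have diff: "C - F = (c^4 * X / (2 * a), - (c^4 * Y / (2 * b)))"
  proof -
    have c4: "c^4 = (a\<^sup>2 - b\<^sup>2)\<^sup>2" using assms(3) by algebra
    show ?thesis
      unfolding C' F c4 using a assms(1) by (simp add: field_simps) algebra
  qed
  have "(dist C F)\<^sup>2 = c^8 * ((cos t)\<^sup>2 * (b * B)\<^sup>2 + (sin t)\<^sup>2 * (a * A)\<^sup>2) / (4 * (a * b * A * B)\<^sup>2)"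
  proof -
    have "(dist C F)\<^sup>2 = (c^4 * X / (2 * a))\<^sup>2 + (c^4 * Y / (2 * b))\<^sup>2"
      unfolding dist_norm diff power2_norm_eq_inner by (simp add: power2_eq_square)
    also have "\<dots> = c^8 * ((cos t)\<^sup>2 * (b * B)\<^sup>2 + (sin t)\<^sup>2 * (a * A)\<^sup>2) / (4 * (a * b * A * B)\<^sup>2)"
      using a assms(1) AB by (simp add: X_def Y_def field_simps)
    finally show ?thesis .
  qed
  \<comment> \<open>After the double-angle formulas the coefficient of \<open>cos (2 * t)\<close> is
    half of \<open>(b * B)\<^sup>2 - (a * A)\<^sup>2\<close>. This difference is
    \<open>- c^6\<close>, because \<open>a * A + b * B = (a + b)^3\<close> and
    \<open>a * A - b * B = (a - b)^3\<close>.\<close>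
  also have "(cos t)\<^sup>2 * (b * B)\<^sup>2 + (sin t)\<^sup>2 * (a * A)\<^sup>2
      = (a^6 + 15 * a^4 * b^2 + 15 * a^2 * b^4 + b^6 - c^6 * cos (2 * t)) / 2"
  proof -
    have "c^6 = (a\<^sup>2 - b\<^sup>2)^3" using assms(3) by algebra
    moreover have "(sin t)\<^sup>2 = (1 - cos (2 * t)) / 2" "(cos t)\<^sup>2 = (1 + cos (2 * t)) / 2"
      by (simp_all add: sin_squared_eq cos_double_cos)
    ultimately show ?thesis unfolding A_def B_def by (simp add: field_simps) algebra
  qed
  also have "a * b * A * B = 3 * a^5 * b + 10 * a^3 * b^3 + 3 * a * b^5"
    unfolding A_def B_def by algebra
  finally have "(dist C F)\<^sup>2 = c^8 * (a^6 + 15 * a^4 * b^2 + 15 * a^2 * b^4 + b^6 - c^6 * cos (2 * t))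
                / (8 * (3 * a^5 * b + 10 * a^3 * b^3 + 3 * a * b^5)^2)"
    by simp
  then show ?thesis
    using locus ellipse_with_axes_closed_segment[of C F] by auto
qed

end
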